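(* Let $H$ be a subgroup of a non-abelian generalized group $G$ such that $G$ has the cancellation law, and let $A=H\times G$. For $(h_1,g_1),(h_2,g_2)\in A$, define $$(h_1,g_1)\circ(h_2,g_2)=(h_1h_2,\;h_2g_1h_2^{-1}g_2).$$ Then $(A,\circ)$ is a Bol quasigroup with a left identity element.
   Context: A generalized group is a non-empty set $G$ with a binary operation (written multiplicatively) such that: (i) $(xy)z=x(yz)$ for all $x,y,z\in G$; (ii) for each $x\in G$ there exists a unique element $e(x)\in G$ such that $xe(x)=e(x)x=x$; (iii) for each $x\in G$ there exists $x^{-1}\in G$ such that $xx^{-1}=x^{-1}x=e(x)$. In a generalized group, the element $x^{-1}$ in (iii) is unique for each $x$. $G$ is non-abelian if $xy\neq yx$ for some $x,y\in G$. A subgroup $H$ of $G$ is a non-empty subset that is a group under the operation of $G$. The cancellation law: for all $x,y,z\in G$, $xy=xz$ implies $y=z$, and $yx=zx$ implies $y=z$. A groupoid is a non-empty set $L$ with a binary operation $\cdot$ such that $x\cdot y\in L$ for all $x,y\in L$; it is a quasigroup if for all $a,b\in L$ the equations $a\cdot x=b$ and $y\cdot a=b$ have unique solutions $x$ and $y$ in $L$, respectively. A Bol quasigroup is a quasigroup satisfying the Bol identity $((xy)z)y=x((yz)y)$ for all $x,y,z$. A left identity element of $(L,\cdot)$ is an element $e\in L$ with $e\cdot x=x$ for all $x\in L$. *)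

theory Defs
  imports "HOL-Algebra.Group"
begin

text \<open>
  Structures are given by a carrier set and a binary operation. The operation is a total function
  on the ambient type, but only its values on the carrier are constrained or used.
\<close>

definition groupoid :: "'a set \<Rightarrow> ('a \<Rightarrow> 'a \<Rightarrow> 'a) \<Rightarrow> bool" where
  "groupoid L m \<longleftrightarrow> L \<noteq> {} \<and> (\<forall>x\<in>L. \<forall>y\<in>L. m x y \<in> L)"

definition is_local_id :: "'a set \<Rightarrow> ('a \<Rightarrow> 'a \<Rightarrow> 'a) \<Rightarrow> 'a \<Rightarrow> 'a \<Rightarrow> bool" where
  "is_local_id G m x e \<longleftrightarrow> e \<in> G \<and> m x e = x \<and> m e x = x"

text \<open>The element \<open>e(x)\<close>; it is meaningful when exactly one local identity of \<open>x\<close> exists.\<close>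

definition local_id :: "'a set \<Rightarrow> ('a \<Rightarrow> 'a \<Rightarrow> 'a) \<Rightarrow> 'a \<Rightarrow> 'a" where
  "local_id G m x = (THE e. is_local_id G m x e)"

definition is_local_inv :: "'a set \<Rightarrow> ('a \<Rightarrow> 'a \<Rightarrow> 'a) \<Rightarrow> 'a \<Rightarrow> 'a \<Rightarrow> bool" where
  "is_local_inv G m x y \<longleftrightarrow> y \<in> G \<and> m x y = local_id G m x \<and> m y x = local_id G m x"

definition generalized_group :: "'a set \<Rightarrow> ('a \<Rightarrow> 'a \<Rightarrow> 'a) \<Rightarrow> bool" where
  "generalized_group G m \<longleftrightarrow>
     groupoid G m \<and>
     (\<forall>x\<in>G. \<forall>y\<in>G. \<forall>z\<in>G. m (m x y) z = m x (m y z)) \<and>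
     (\<forall>x\<in>G. \<exists>!e. is_local_id G m x e) \<and>
     (\<forall>x\<in>G. \<exists>y. is_local_inv G m x y)"

definition local_inv :: "'a set \<Rightarrow> ('a \<Rightarrow> 'a \<Rightarrow> 'a) \<Rightarrow> 'a \<Rightarrow> 'a" where
  "local_inv G m x = (THE y. is_local_inv G m x y)"

text \<open>Uniqueness of inverses, which justifies the description operator in \<open>local_inv\<close>.\<close>

lemma local_id_eqI:
  assumes "generalized_group G m" "x \<in> G" "is_local_id G m x e"
  shows "local_id G m x = e"
  using assms unfolding generalized_group_def local_id_def by (blast intro: the1_equality)

lemma is_local_id_local_id:
  assumes "generalized_group G m" "x \<in> G"
  shows "is_local_id G m x (local_id G m x)"
  using assms unfolding generalized_group_def local_id_def by (blast intro: theI')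

lemma local_id_of_local_inv:
  assumes gg: "generalized_group G m" and x: "x \<in> G" and y: "is_local_inv G m x y"
  shows "local_id G m y = local_id G m x"
proof -
  let ?e = "local_id G m x" and ?f = "local_id G m y"
  have assoc: "m (m a b) c = m a (m b c)" if "a \<in> G" "b \<in> G" "c \<in> G" for a b c
    using gg that unfolding generalized_group_def by blast
  have yG: "y \<in> G" and xy: "m x y = ?e" and yx: "m y x = ?e"
    using y by (auto simp: is_local_inv_def)
  have e: "?e \<in> G" "m x ?e = x" "m ?e x = x"
    using is_local_id_local_id[OF gg x] by (auto simp: is_local_id_def)
  have f: "?f \<in> G" "m y ?f = y" "m ?f y = y"
    using is_local_id_local_id[OF gg yG] by (auto simp: is_local_id_def)
  have "m ?e ?e = ?e" using assoc[OF yG x e(1)] e yx by simp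
  moreover have "m ?e ?f = ?e" using assoc[OF x yG f(1)] f xy by simp
  moreover have "m ?f ?e = ?e" using assoc[OF f(1) yG x] f yx by simp
  ultimately have "is_local_id G m ?e ?e" "is_local_id G m ?e ?f"
    using e f by (auto simp: is_local_id_def)
  then show ?thesis using local_id_eqI[OF gg e(1)] by metis
qed

lemma ex1_local_inv:
  assumes gg: "generalized_group G m" and x: "x \<in> G"
  shows "\<exists>!y. is_local_inv G m x y"
proof (rule ex_ex1I)
  show "\<exists>y. is_local_inv G m x y" using gg x unfolding generalized_group_def by blast
next
  fix y z assume y: "is_local_inv G m x y" and z: "is_local_inv G m x z"
  let ?e = "local_id G m x"
  have G: "y \<in> G" "z \<in> G" and "m y x = ?e" "m x z = ?e"
    using y z by (auto simp: is_local_inv_def)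
  moreover have "m y ?e = y" "m ?e z = z"
    using is_local_id_local_id[OF gg] local_id_of_local_inv[OF gg x] y z G
    by (metis is_local_id_def)+
  moreover have "m (m y x) z = m y (m x z)"
    using gg x G unfolding generalized_group_def by blast
  ultimately show "y = z" by simp
qed

lemma is_local_inv_local_inv:
  assumes "generalized_group G m" "x \<in> G"
  shows "is_local_inv G m x (local_inv G m x)"
  using ex1_local_inv[OF assms] unfolding local_inv_def by (rule theI')

definition non_abelian :: "'a set \<Rightarrow> ('a \<Rightarrow> 'a \<Rightarrow> 'a) \<Rightarrow> bool" where
  "non_abelian G m \<longleftrightarrow> (\<exists>x\<in>G. \<exists>y\<in>G. m x y \<noteq> m y x)"

definition cancellation_law :: "'a set \<Rightarrow> ('a \<Rightarrow> 'a \<Rightarrow> 'a) \<Rightarrow> bool" where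
  "cancellation_law G m \<longleftrightarrow>
     (\<forall>x\<in>G. \<forall>y\<in>G. \<forall>z\<in>G. (m x y = m x z \<longrightarrow> y = z) \<and> (m y x = m z x \<longrightarrow> y = z))"

text \<open>
  The ambient structure has no distinguished identity element, so being a group under the given
  operation means that \<open>group\<close> holds for some choice of the identity.
\<close>

definition gg_subgroup :: "'a set \<Rightarrow> 'a set \<Rightarrow> ('a \<Rightarrow> 'a \<Rightarrow> 'a) \<Rightarrow> bool" where
  "gg_subgroup H G m \<longleftrightarrow>
     H \<noteq> {} \<and> H \<subseteq> G \<and> (\<exists>u. group \<lparr>carrier = H, monoid.mult = m, one = u\<rparr>)"

definition quasigroup :: "'a set \<Rightarrow> ('a \<Rightarrow> 'a \<Rightarrow> 'a) \<Rightarrow> bool" where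
  "quasigroup L m \<longleftrightarrow>
     groupoid L m \<and>
     (\<forall>a\<in>L. \<forall>b\<in>L. (\<exists>!x. x \<in> L \<and> m a x = b) \<and> (\<exists>!y. y \<in> L \<and> m y a = b))"

definition bol_quasigroup :: "'a set \<Rightarrow> ('a \<Rightarrow> 'a \<Rightarrow> 'a) \<Rightarrow> bool" where
  "bol_quasigroup L m \<longleftrightarrow>
     quasigroup L m \<and>
     (\<forall>x\<in>L. \<forall>y\<in>L. \<forall>z\<in>L. m (m (m x y) z) y = m x (m (m y z) y))"

definition left_identity :: "'a set \<Rightarrow> ('a \<Rightarrow> 'a \<Rightarrow> 'a) \<Rightarrow> 'a \<Rightarrow> bool" where
  "left_identity L m e \<longleftrightarrow> e \<in> L \<and> (\<forall>x\<in>L. m e x = x)"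

text \<open>
  \<open>(h\<^sub>1, g\<^sub>1) \<circ> (h\<^sub>2, g\<^sub>2) = (h\<^sub>1 h\<^sub>2, h\<^sub>2 g\<^sub>1 h\<^sub>2\<^sup>-\<^sup>1 g\<^sub>2)\<close>, the last product being bracketed to the left.
\<close>

definition bol_op ::
    "'a set \<Rightarrow> ('a \<Rightarrow> 'a \<Rightarrow> 'a) \<Rightarrow> 'a \<times> 'a \<Rightarrow> 'a \<times> 'a \<Rightarrow> 'a \<times> 'a" where
  "bol_op G m = (\<lambda>(h1, g1) (h2, g2). (m h1 h2, m (m (m h2 g1) (local_inv G m h2)) g2))"

end

theory Submission
  imports Defs
begin

text \<open>
  By cancellation, \<open>x e(x) y = x y\<close> gives \<open>e(x) y = y\<close> for all \<open>y\<close>, so all local identities coincide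
  and \<open>G\<close> is a group containing \<open>H\<close> as a subgroup. The Bol identity then holds because
  \<open>(h\<^sub>2 h\<^sub>3 h\<^sub>2)\<^sup>-\<^sup>1 h\<^sub>2 h\<^sub>3 = h\<^sub>2\<^sup>-\<^sup>1\<close>; both equations are solved first in the \<open>H\<close>-component, and \<open>(1, 1)\<close>
  is a left identity.
\<close>

lemma group_of_cancellative_generalized_group:
  assumes gg: "generalized_group G m" and canc: "cancellation_law G m"
  obtains e where "group \<lparr>carrier = G, monoid.mult = m, one = e\<rparr>"
proof -
  have closed: "m x y \<in> G" if "x \<in> G" "y \<in> G" for x y
    using gg that unfolding generalized_group_def groupoid_def by blast
  have assoc: "m (m x y) z = m x (m y z)" if "x \<in> G" "y \<in> G" "z \<in> G" for x y z
    using gg that unfolding generalized_group_def by blast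
  have lcanc: "y = z" if "m x y = m x z" "x \<in> G" "y \<in> G" "z \<in> G" for x y z
    using canc that unfolding cancellation_law_def by blast
  have rcanc: "y = z" if "m y x = m z x" "x \<in> G" "y \<in> G" "z \<in> G" for x y z
    using canc that unfolding cancellation_law_def by blast
  have id: "local_id G m x \<in> G" "m x (local_id G m x) = x" "m (local_id G m x) x = x"
    if "x \<in> G" for x
    using is_local_id_local_id[OF gg that] by (auto simp: is_local_id_def)
  have lunit: "m (local_id G m x) y = y" if "x \<in> G" "y \<in> G" for x y
    by (rule lcanc[of x]) (use that in \<open>simp_all add: closed id assoc[symmetric]\<close>)
  have runit: "m y (local_id G m x) = y" if "x \<in> G" "y \<in> G" for x y
    by (rule rcanc[of _ x]) (use that in \<open>simp_all add: closed id assoc\<close>)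
  \<comment> \<open>The product e(x) e(y) equals e(y) by \<open>lunit\<close> and e(x) by
    \<open>runit\<close>.\<close>
  have id_eq: "local_id G m x = local_id G m y" if "x \<in> G" "y \<in> G" for x y
    using lunit[OF that(1) id(1)[OF that(2)]] runit[OF that(2) id(1)[OF that(1)]] by simp
  obtain a where a: "a \<in> G"
    using gg unfolding generalized_group_def groupoid_def by blast
  have "group \<lparr>carrier = G, monoid.mult = m, one = local_id G m a\<rparr>"
  proof (rule groupI, simp_all add: a closed assoc id lunit)
    \<comment> \<open>A local inverse of \<open>x\<close> is inverse relative to e(x), which
      \<open>id_eq\<close> turns into the common unit e(a).\<close>
    fix x assume x: "x \<in> G"
    show "\<exists>y\<in>G. m y x = local_id G m a"
      using is_local_inv_local_inv[OF gg x] id_eq[OF a x] by (auto simp: is_local_inv_def)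
  qed
  then show thesis by (rule that)
qed

context group
begin

text \<open>The group unit is a local identity of every \<open>x\<close>, so by uniqueness it is
  e(x), and a local inverse is then an ordinary inverse.\<close>

lemma local_inv_eq_inv:
  assumes gg: "generalized_group (carrier G) (mult G)" and x: "x \<in> carrier G"
  shows "local_inv (carrier G) (mult G) x = inv x"
proof -
  have "local_id (carrier G) (mult G) x = \<one>"
    by (rule local_id_eqI[OF gg x]) (simp add: is_local_id_def x)
  then show ?thesis
    using is_local_inv_local_inv[OF gg x] x by (auto simp: is_local_inv_def intro: inv_equality[symmetric])
qed

text \<open>The unit \<open>u\<close> of \<open>H\<close> is idempotent, and \<one> is the only
  idempotent of a group. With equal units, inverses taken in \<open>H\<close> are inverses in the
  whole group.\<close>

lemma subgroup_if_gg_subgroup: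
  assumes "gg_subgroup H (carrier G) (mult G)"
  shows "subgroup H G"
proof -
  obtain u where sub: "H \<subseteq> carrier G"
    and grp: "group \<lparr>carrier = H, monoid.mult = mult G, one = u\<rparr>" (is "group ?H")
    using assms unfolding gg_subgroup_def by blast
  interpret H: group ?H by (rule grp)
  have u: "u \<in> H" "u \<otimes> u = u" using H.one_closed H.l_one[of u] by simp_all
  then have "u = \<one>" using sub by (metis l_cancel_one' subsetD)
  show ?thesis
  proof (rule subgroupI)
    fix x assume x: "x \<in> H"
    then have y: "inv\<^bsub>?H\<^esub> x \<in> H" "inv\<^bsub>?H\<^esub> x \<otimes> x = \<one>"
      using H.inv_closed[of x] H.l_inv[of x] \<open>u = \<one>\<close> by simp_all
    then have "inv x = inv\<^bsub>?H\<^esub> x"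
      using x sub by (intro inv_equality) auto
    then show "inv x \<in> H" using y by simp
  next
    fix x y assume "x \<in> H" "y \<in> H"
    then show "x \<otimes> y \<in> H" using H.m_closed[of x y] by simp
  qed (use sub u in auto)
qed

text \<open>Once products are bracketed to the right, a factor and its adjacent inverse are no
  longer a subterm; these rules let the simplifier still cancel them.\<close>

lemma inv_mult_cancel:
  assumes "x \<in> carrier G" "y \<in> carrier G"
  shows "inv x \<otimes> (x \<otimes> y) = y" and "x \<otimes> (inv x \<otimes> y) = y"
  using assms by (simp_all add: m_assoc[symmetric])

context
  fixes H
  assumes gg: "generalized_group (carrier G) (mult G)" and H: "subgroup H G"
begin

abbreviation bol (infixl "\<circ>\<^sub>B" 70)
  where "bol \<equiv> bol_op (carrier G) (mult G)"

lemma bol_eq: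
  assumes "h' \<in> H"
  shows "(h, g) \<circ>\<^sub>B (h', g') = (h \<otimes> h', h' \<otimes> g \<otimes> inv h' \<otimes> g')"
  using local_inv_eq_inv[OF gg subgroup.mem_carrier[OF H assms]] by (simp add: bol_op_def)

lemmas H_closed = subgroup.mem_carrier[OF H] subgroup.m_closed[OF H]
  subgroup.m_inv_closed[OF H] subgroup.one_closed[OF H]

text \<open>The first coordinate forces the first entry of \<open>x\<close> to be
  \<open>inv h \<otimes> k\<close>. This fixes the conjugate of \<open>g\<close>, and a left
  translation by it remains to be inverted.\<close>

lemma bol_right_solution:
  assumes "h \<in> H" "g \<in> carrier G" "k \<in> H" "l \<in> carrier G"
  shows "\<exists>!x. x \<in> H \<times> carrier G \<and> (h, g) \<circ>\<^sub>B x = (k, l)"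
proof (rule ex1I)
  define a where "a = inv h \<otimes> k"
  have a: "a \<in> H" "a \<in> carrier G" using assms by (auto simp: a_def H_closed)
  let ?x = "(a, inv (a \<otimes> g \<otimes> inv a) \<otimes> l)"
  show "?x \<in> H \<times> carrier G \<and> (h, g) \<circ>\<^sub>B ?x = (k, l)"
    \<comment> \<open>The second coordinate is right for any \<open>a\<close> in \<open>H\<close>;
      the value of \<open>a\<close> matters only for \<open>h \<otimes> a = k\<close>.\<close>
    using assms a by (simp add: bol_eq H_closed inv_mult_cancel) (simp add: a_def H_closed inv_mult_cancel)
  fix x assume x: "x \<in> H \<times> carrier G \<and> (h, g) \<circ>\<^sub>B x = (k, l)"
  obtain b c where bc: "x = (b, c)" "b \<in> H" "c \<in> carrier G" using x by auto
  then have k: "k = h \<otimes> b" and l: "l = b \<otimes> g \<otimes> inv b \<otimes> c" using x by (simp_all add: bol_eq)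
  have "a = b" unfolding a_def k using assms bc by (simp add: inv_mult_cancel H_closed)
  then show "x = ?x" unfolding bc l using assms bc by (simp add: inv_mult_cancel H_closed)
qed

text \<open>Here the conjugating element \<open>h\<close> is known, so the coordinates decouple:
  \<open>b \<otimes> h = k\<close> and \<open>h \<otimes> c \<otimes> inv h \<otimes> g = l\<close>
  are solved separately.\<close>

lemma bol_left_solution:
  assumes "h \<in> H" "g \<in> carrier G" "k \<in> H" "l \<in> carrier G"
  shows "\<exists>!y. y \<in> H \<times> carrier G \<and> y \<circ>\<^sub>B (h, g) = (k, l)"
proof (rule ex1I)
  let ?y = "(k \<otimes> inv h, inv h \<otimes> l \<otimes> inv g \<otimes> h)"
  show "?y \<in> H \<times> carrier G \<and> ?y \<circ>\<^sub>B (h, g) = (k, l)"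
    using assms by (simp add: bol_eq H_closed m_assoc inv_mult_cancel)
  fix y assume y: "y \<in> H \<times> carrier G \<and> y \<circ>\<^sub>B (h, g) = (k, l)"
  obtain b c where bc: "y = (b, c)" "b \<in> H" "c \<in> carrier G" using y by auto
  then have kl: "k = b \<otimes> h" "l = h \<otimes> c \<otimes> inv h \<otimes> g" using y assms by (simp_all add: bol_eq)
  show "y = ?y" unfolding bc kl using assms bc by (simp add: m_assoc inv_mult_cancel H_closed)
qed

lemma bol_quasigroup_bol: "bol_quasigroup (H \<times> carrier G) bol"
  unfolding bol_quasigroup_def quasigroup_def groupoid_def
proof (intro conjI ballI)
  show "H \<times> carrier G \<noteq> {}" using H_closed(4) by auto
next
  fix x y assume "x \<in> H \<times> carrier G" "y \<in> H \<times> carrier G"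
  then show "x \<circ>\<^sub>B y \<in> H \<times> carrier G" by (auto simp: bol_eq H_closed)
next
  fix a b assume "a \<in> H \<times> carrier G" "b \<in> H \<times> carrier G"
  then obtain h g k l where ab: "a = (h, g)" "b = (k, l)"
    and mem: "h \<in> H" "g \<in> carrier G" "k \<in> H" "l \<in> carrier G" by blast
  show "\<exists>!x. x \<in> H \<times> carrier G \<and> a \<circ>\<^sub>B x = b"
    unfolding ab by (rule bol_right_solution[OF mem])
  show "\<exists>!y. y \<in> H \<times> carrier G \<and> y \<circ>\<^sub>B a = b"
    unfolding ab by (rule bol_left_solution[OF mem])
next
  fix x y z assume "x \<in> H \<times> carrier G" "y \<in> H \<times> carrier G" "z \<in> H \<times> carrier G"
  \<comment> \<open>For x = (p, a), y = (q, b), z = (r, c), both second coordinates reduce to the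
    word q r q a q' b r' c q' b, where a prime marks an inverse.\<close>
  then show "x \<circ>\<^sub>B y \<circ>\<^sub>B z \<circ>\<^sub>B y = x \<circ>\<^sub>B (y \<circ>\<^sub>B z \<circ>\<^sub>B y)"
    by (auto simp: bol_eq H_closed m_assoc inv_mult_group inv_mult_cancel)
qed

lemma left_identity_bol: "left_identity (H \<times> carrier G) bol (\<one>, \<one>)"
  by (auto simp: left_identity_def bol_eq H_closed)

end

end

theorem corollary3p2:
  fixes G H :: "'a set" and m :: "'a \<Rightarrow> 'a \<Rightarrow> 'a"
  assumes "generalized_group G m"
    and "non_abelian G m"
    and "cancellation_law G m"
    and "gg_subgroup H G m"
  shows "bol_quasigroup (H \<times> G) (bol_op G m) \<and> (\<exists>e. left_identity (H \<times> G) (bol_op G m) e)"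
proof -
  obtain e where "group \<lparr>carrier = G, monoid.mult = m, one = e\<rparr>" (is "group ?G")
    using group_of_cancellative_generalized_group[OF assms(1,3)] .
  then interpret group ?G .
  \<comment> \<open>The results for \<open>group\<close> speak of \<open>carrier\<close> and
    \<open>mult\<close>; on the record \<open>?G\<close> these reduce to \<open>G\<close> and
    \<open>m\<close>.\<close>
  have gg: "generalized_group (carrier ?G) (mult ?G)" using assms(1) by simp
  have H: "subgroup H ?G" by (rule subgroup_if_gg_subgroup) (simp add: assms(4))
  show ?thesis
    using bol_quasigroup_bol[OF gg H] left_identity_bol[OF gg H] by auto
qed

end
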